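(* Let $n$ be a positive integer, and let $a,b,c,d$ be integers such that $a+d=b+c$ and $abcd=n$. Then the rational triple $$\left(\frac{b+c}{2},\frac{a-b}{2},\frac{a-c}{2}\right)$$ is a solution $(x,y,z)$ to the equation $$x^4+y^4+z^4-2x^2y^2-2y^2z^2-2z^2x^2=n.$$ Consequently, for every permutation $(x_0,y_0,z_0)$ of the triple $\left(\frac{b+c}{2},\frac{a-b}{2},\frac{a-c}{2}\right)$, all the triples $(\pm x_0,\pm y_0,\pm z_0)$, with any of the eight possible sign combinations, are also rational solutions of this equation. *)

theory Defs
  imports Complex_Main "HOL-Combinatorics.List_Permutation"
begin

definition quartic_solution :: "int \<Rightarrow> rat \<times> rat \<times> rat \<Rightarrow> bool" where
  "quartic_solution n = (\<lambda>(x, y, z).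
     x^4 + y^4 + z^4 - 2 * x^2 * y^2 - 2 * y^2 * z^2 - 2 * z^2 * x^2 = of_int n)"

end

theory Submission
  imports Defs
begin

text \<open>
  The quartic form splits into the four linear forms \<open>x + y + z\<close>, \<open>x - y - z\<close>, \<open>x + y - z\<close> and
  \<open>x - y + z\<close> (it is minus Heron's product).  For the given triple these take the values
  \<open>a\<close>, \<open>d = b + c - a\<close>, \<open>c\<close> and \<open>b\<close>, so the form takes the value \<open>abcd = n\<close>.

  The form also equals \<open>2 (x\<^sup>4 + y\<^sup>4 + z\<^sup>4) - (x\<^sup>2 + y\<^sup>2 + z\<^sup>2)\<^sup>2\<close>.  Here only even powers
  occur, and only through sums over the entries, so neither signs nor the order of the entries matter.
\<close>

lemma quartic_solution_iff_linear_factors: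
  "quartic_solution n (x, y, z) \<longleftrightarrow>
     (x + y + z) * (x - y - z) * (x + y - z) * (x - y + z) = of_int n"
  unfolding quartic_solution_def prod.case
  by (simp add: power4_eq_xxxx power2_eq_square algebra_simps)

text \<open>Sums over a list depend only on its multiset of entries, which is what a permutation preserves.\<close>

lemma quartic_solution_iff_power_sums:
  "quartic_solution n (x, y, z) \<longleftrightarrow>
     2 * (\<Sum>v\<leftarrow>[x, y, z]. v ^ 4) - (\<Sum>v\<leftarrow>[x, y, z]. v ^ 2) ^ 2 = of_int n"
  unfolding quartic_solution_def prod.case
  by (simp add: power4_eq_xxxx power2_eq_square algebra_simps)

lemma quartic_solution_perm:
  assumes "[x', y', z'] <~~> [x, y, z]"
  shows "quartic_solution n (x', y', z') \<longleftrightarrow> quartic_solution n (x, y, z)"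
proof -
  have "(\<Sum>v\<leftarrow>[x', y', z']. v ^ k) = (\<Sum>v\<leftarrow>[x, y, z]. v ^ k)" for k
    using assms by (metis mset_map sum_mset_sum_list)
  then show ?thesis
    by (simp only: quartic_solution_iff_power_sums)
qed

lemma quartic_solution_signs:
  assumes "s \<in> {1, -1}" "t \<in> {1, -1}" "u \<in> {1, -1}"
  shows "quartic_solution n (s * x, t * y, u * z) \<longleftrightarrow> quartic_solution n (x, y, z)"
  using assms by (auto simp: quartic_solution_def)

theorem theorem2:
  fixes n a b c d :: int and x y z :: rat
  assumes "n > 0"
    and "a + d = b + c"
    and "a * b * c * d = n"
  defines "x \<equiv> of_int (b + c) / 2"
    and "y \<equiv> of_int (a - b) / 2"
    and "z \<equiv> of_int (a - c) / 2"
  shows "quartic_solution n (x, y, z) \<and>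
    (\<forall>x0 y0 z0. [x0, y0, z0] <~~> [x, y, z] \<longrightarrow>
      (\<forall>s\<in>{1, -1}. \<forall>t\<in>{1, -1}. \<forall>u\<in>{1, -1}.
        quartic_solution n (s * x0, t * y0, u * z0)))"
proof -
  have d: "d = b + c - a"
    using assms(2) by simp
  have factors: "x + y + z = of_int a" "x - y - z = of_int d"
      "x + y - z = of_int c" "x - y + z = of_int b"
    unfolding x_def y_def z_def d by (simp_all add: field_simps)
  have "quartic_solution n (x, y, z)"
    unfolding quartic_solution_iff_linear_factors factors
    by (simp add: assms(3)[symmetric] mult_ac)
  then show ?thesis
    using quartic_solution_perm quartic_solution_signs by blast
qed

end
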